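(* Let $a,b\geq 1$ be integers with $\gcd(a,b)=1$, and suppose $(a,b)$ is not one of $(29,1)$, $(45,1)$, $(47,1)$, $(50,1)$, $(55,1)$, $(67,1)$, $(73,1)$, $(79,1)$. Then $$F(S(a,b))\geq\frac{a}{2}\left(1+\sqrt{8a-7}\right)+ab-a-b$$ and $$F(S(a,b))\leq\frac{a}{2}\left(3+\sqrt{24a-15}\right)+ab-a-b.$$
   Context: $\mathbb{N}_0=\{0,1,2,\ldots\}$ and $\binom{n}{2}=\frac{n(n-1)}{2}$. For $a,b\in\mathbb{N}_0$, $S(a,b)$ is the submonoid of $(\mathbb{N}_0,+)$ generated by $\left\{na+\binom{n}{2}b : n\in\mathbb{N}_0\right\}$; it is a numerical semigroup (a submonoid of $\mathbb{N}_0$ with finite complement) exactly when $\gcd(a,b)=1$. For a numerical semigroup $S$, the Frobenius number $F(S)$ is the greatest integer not in $S$.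
   Formalization: The lower bound is asserted only for a ≥ 2, since for a = 1 we have S(1,b) = N_0 and F = -1, while the stated lower bound equals 0; the upper bound is kept for all a ≥ 1. *)

theory Defs
  imports Complex_Main "HOL.Hull"
begin

definition add_submonoid :: "'a::monoid_add set \<Rightarrow> bool" where
  "add_submonoid M \<longleftrightarrow> 0 \<in> M \<and> (\<forall>x\<in>M. \<forall>y\<in>M. x + y \<in> M)"

definition S :: "nat \<Rightarrow> nat \<Rightarrow> nat set" where
  "S a b = add_submonoid hull (range (\<lambda>n. n * a + (n choose 2) * b))"

text \<open>The greatest element is taken over the integers, so that the numerical semigroup of all
  natural numbers has Frobenius number -1. For a set of naturals with finite complement
  the greatest element exists; otherwise the value is unspecified.\<close>

definition frobenius :: "nat set \<Rightarrow> int" where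
  "frobenius T = (GREATEST x. x \<notin> int ` T)"

text \<open>The case a = 1 is degenerate: the Frobenius number is -1, while
  (a/2) (1 + sqrt (8 a - 7)) + a b - a - b evaluates to 0. Hence the lower
  bound on the Frobenius number can only hold for a at least 2.\<close>

lemma S_1: "S 1 b = UNIV"
proof -
  have "n \<in> M" if "add_submonoid M" "range (\<lambda>n. n * 1 + (n choose 2) * b) \<subseteq> M" for M n
  proof (induction n)
    case 0
    then show ?case using that(1) by (simp add: add_submonoid_def)
  next
    case (Suc n)
    have "1 * 1 + (1 choose 2) * b \<in> M" using that(2) by blast
    then have "1 \<in> M" by (simp add: binomial_eq_0)
    then show ?case using Suc that(1) unfolding add_submonoid_def by (metis Suc_eq_plus1)
  qed
  then show ?thesis unfolding S_def hull_def by auto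
qed

lemma frobenius_S_1: "frobenius (S 1 b) = -1"
  unfolding frobenius_def S_1
proof (rule Greatest_equality)
  show "y \<le> -1" if "y \<notin> range int" for y
    using that by (metis not_less rangeI zero_le_imp_eq_int zle_add1_eq_le add.left_inverse)
qed auto

end

theory Submission
  imports Defs "HOL-Number_Theory.Cong"
begin

text \<open>Every element of \<open>S a b\<close> has the form \<open>x * a + y * b\<close>, where \<open>x\<close> is the sum of some
  \<open>n\<^sub>i\<close> and \<open>y\<close> the sum of the \<open>n\<^sub>i choose 2\<close>; since \<open>n = 1\<close> contributes \<open>(1, 0)\<close>, only the
  least \<open>x = m y\<close> for a given \<open>y\<close> matters. Superadditivity of \<open>n choose 2\<close> bounds \<open>m y\<close>
  from below by the positive root of \<open>x (x - 1) = 2 y\<close>, and the residue class of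
  \<open>(a - 1) * b\<close> modulo \<open>a\<close> gives the lower bound for the Frobenius number.
  The upper bound needs \<open>2 * m y \<le> 3 + sqrt (24 * y + 9)\<close>. This follows at once from
  Gauss' theorem on three triangular numbers, but it is cheaper to split off the largest
  triangular number below \<open>y\<close> and induct, which succeeds for \<open>y \<ge> 36\<close>.\<close>

lemma choose_two_add: "(m + n) choose 2 = (m choose 2) + (n choose 2) + m * n"
  by (induction m) (auto simp: numeral_2_eq_2)

lemma of_nat_choose_two: "2 * real (n choose 2) = real n * (real n - 1)"
  by (induction n) (auto simp: numeral_2_eq_2 algebra_simps)

lemma add_submonoid_S: "add_submonoid (S a b)"
  by (auto simp: S_def hull_def add_submonoid_def)

lemma zero_in_S: "0 \<in> S a b"
  and add_in_S: "x \<in> S a b \<Longrightarrow> y \<in> S a b \<Longrightarrow> x + y \<in> S a b"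
  using add_submonoid_S by (auto simp: add_submonoid_def)

lemma generator_in_S: "n * a + (n choose 2) * b \<in> S a b"
  unfolding S_def by (rule hull_inc) blast

lemma mult_in_S: "n * a \<in> S a b"
proof (induction n)
  case (Suc n)
  then show ?case
    using add_in_S[OF generator_in_S[of 1 a b]] by (simp add: binomial_eq_0)
qed (simp add: zero_in_S)

text \<open>Pairs with \<open>y \<le> x choose 2\<close> are closed under addition, as the cross
  term in \<open>choose_two_add\<close> is nonnegative.\<close>

lemma S_elim:
  assumes "z \<in> S a b"
  obtains x y where "z = x * a + y * b" "y \<le> x choose 2"
proof -
  define M where "M = {x * a + y * b | x y. y \<le> x choose 2}"
  have "u + v \<in> M" if u: "u \<in> M" and v: "v \<in> M" for u v
  proof -
    obtain x y where u: "u = x * a + y * b" "y \<le> x choose 2"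
      using u by (auto simp: M_def)
    obtain x' y' where v: "v = x' * a + y' * b" "y' \<le> x' choose 2"
      using v by (auto simp: M_def)
    have "u + v = (x + x') * a + (y + y') * b" "y + y' \<le> (x + x') choose 2"
      using u v by (simp_all add: choose_two_add algebra_simps)
    then show ?thesis unfolding M_def by blast
  qed
  moreover have "0 \<in> M" unfolding M_def by force
  ultimately have "add_submonoid M" by (simp add: add_submonoid_def)
  moreover have "range (\<lambda>n. n * a + (n choose 2) * b) \<subseteq> M"
    unfolding M_def by blast
  ultimately have "S a b \<subseteq> M" unfolding S_def by (rule hull_minimal[rotated])
  with assms that show thesis by (auto simp: M_def)
qed

text \<open>Scaling by 8 and completing the square gives
  \<open>8 * y + 1 \<le> (2 * x - 1)\<^sup>2\<close>; \<open>y > 0\<close> excludes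
  \<open>x = 0\<close>, where \<open>2 * x - 1\<close> is negative.\<close>

lemma choose_two_root_bound:
  assumes "y \<le> x choose 2" "y > 0"
  shows "1 + sqrt (8 * real y + 1) \<le> 2 * real x"
proof -
  have "x \<noteq> 0" using assms by (cases x) (auto simp: numeral_2_eq_2)
  moreover have "8 * real y + 1 \<le> (2 * real x - 1)\<^sup>2"
    using assms(1) of_nat_choose_two[of x] by (simp add: power2_eq_square algebra_simps)
  ultimately have "sqrt (8 * real y + 1) \<le> 2 * real x - 1"
    by (intro real_le_lsqrt) auto
  then show ?thesis by simp
qed

lemma three_triangular_small:
  assumes "y < 36"
  shows "\<exists>p q r. y = (p choose 2) + (q choose 2) + (r choose 2)"
proof -
  \<comment> \<open>Entry \<open>y\<close> is a witness for \<open>y\<close>; a component 1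
    contributes 0.\<close>
  define ts :: "(nat \<times> nat \<times> nat) list" where "ts = [
      (1,1,1), (2,1,1), (2,2,1), (3,1,1), (3,2,1), (3,2,2), (4,1,1), (4,2,1), (4,2,2),
      (4,3,1), (5,1,1), (5,2,1), (4,4,1), (5,3,1), (5,3,2), (6,1,1), (6,2,1), (6,2,2),
      (6,3,1), (6,3,2), (5,5,1), (7,1,1), (7,2,1), (7,2,2), (7,3,1), (6,5,1), (6,5,2),
      (7,4,1), (8,1,1), (8,2,1), (6,6,1), (8,3,1), (8,3,2), (6,6,3), (8,4,1), (8,4,2)]"
  let ?f = "\<lambda>(p, q, r). (p choose 2) + (q choose 2) + (r choose 2)"
  have "length ts = 36" by (simp add: ts_def)
  then have "?f (ts ! y) = map ?f ts ! y" using assms by simp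
  also have "map ?f ts = [0..<36]" by (simp add: ts_def choose_two upt_conv_Cons)
  finally have "?f (ts ! y) = y" using assms by simp
  moreover obtain p q r where "ts ! y = (p, q, r)" by (rule prod_cases3)
  ultimately have "y = (p choose 2) + (q choose 2) + (r choose 2)" by simp
  then show ?thesis by blast
qed

text \<open>Consecutive values of \<open>n choose 2\<close> differ by \<open>n\<close>, so a
  remainder reaching \<open>n\<close> rolls over to the next one.\<close>

lemma largest_choose_two:
  obtains n r where "y = (n choose 2) + r" "r < n"
proof -
  have "\<exists>n r. y = (n choose 2) + r \<and> r < n"
  proof (induction y)
    case 0
    have "0 = (1 choose 2) + 0 \<and> (0::nat) < 1" by (simp add: binomial_eq_0)
    then show ?case by blast
  next
    case (Suc y)
    then obtain n r where nr: "y = (n choose 2) + r" "r < n" by blast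
    show ?case
    proof (cases "Suc r = n")
      case True
      with nr have "Suc y = (Suc n choose 2) + 0 \<and> 0 < Suc n"
        by (simp add: numeral_2_eq_2)
      then show ?thesis by blast
    next
      case False
      with nr have "Suc y = (n choose 2) + Suc r \<and> Suc r < n" by simp
      then show ?thesis by blast
    qed
  qed
  with that show thesis by blast
qed

text \<open>The bound is what Cauchy-Schwarz yields for three triangular numbers; the induction
  preserves it although more summands may occur.\<close>

lemma short_representation:
  "\<exists>x. x * a + y * b \<in> S a b \<and> 2 * real x \<le> 3 + sqrt (24 * real y + 9)"
proof (induction y rule: less_induct)
  case (less y)
  show ?case
  proof (cases "y < 36")
    case True
    then obtain p q r where y: "y = (p choose 2) + (q choose 2) + (r choose 2)"
      using three_triangular_small by blast
    have "(p + q + r) * a + y * b \<in> S a b"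
      using add_in_S[OF add_in_S[OF generator_in_S[of p] generator_in_S[of q]] generator_in_S[of r]]
      by (simp add: y algebra_simps)
    moreover have "2 * real (p + q + r) \<le> 3 + sqrt (24 * real y + 9)"
    proof -
      \<comment> \<open>Cauchy-Schwarz for the three odd numbers \<open>2 n\<^sub>i - 1\<close>, whose squares sum to \<open>8 y + 3\<close>\<close>
      define u v w where "u = 2 * real p - 1" "v = 2 * real q - 1" "w = 2 * real r - 1"
      have "u\<^sup>2 + v\<^sup>2 + w\<^sup>2 = 8 * real y + 3"
        using of_nat_choose_two[of p] of_nat_choose_two[of q] of_nat_choose_two[of r]
        by (simp add: u_v_w_def y power2_eq_square algebra_simps)
      moreover have "(u + v + w)\<^sup>2 \<le> 3 * (u\<^sup>2 + v\<^sup>2 + w\<^sup>2)"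
        using zero_le_power2[of "u - v"] zero_le_power2[of "v - w"] zero_le_power2[of "u - w"]
        unfolding power2_eq_square by (simp add: algebra_simps)
      ultimately have "(u + v + w)\<^sup>2 \<le> 24 * real y + 9" by simp
      then have "u + v + w \<le> sqrt (24 * real y + 9)" by (rule real_le_rsqrt)
      then show ?thesis by (simp add: u_v_w_def)
    qed
    ultimately show ?thesis by blast
  next
    case False
    obtain n r where nr: "y = (n choose 2) + r" "r < n" by (rule largest_choose_two)
    \<comment> \<open>For \<open>n \<le> 8\<close> the value of \<open>y\<close> is at most 28 + 7 =
      35.\<close>
    have n: "n \<ge> 9"
    proof (rule ccontr)
      assume "\<not> n \<ge> 9"
      then have "n choose 2 \<le> 8 choose 2" using choose_two_add[of n "8 - n"] by simp
      with nr False \<open>\<not> n \<ge> 9\<close> show False by (simp add: choose_two)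
    qed
    then have "r < y" by (simp add: nr zero_less_binomial)
    then obtain x where x: "x * a + r * b \<in> S a b" "2 * real x \<le> 3 + sqrt (24 * real r + 9)"
      using less by blast
    have "(n + x) * a + y * b \<in> S a b"
      using add_in_S[OF generator_in_S[of n] x(1)] by (simp add: nr algebra_simps)
    moreover have "2 * real (n + x) \<le> 3 + sqrt (24 * real y + 9)"
    proof -
      define s where "s = sqrt (24 * real r + 9)"
      have s2: "s\<^sup>2 = 24 * real r + 9" by (simp add: s_def)
      \<comment> \<open>With \<open>r \<le> n - 1\<close> it suffices that
        \<open>n * n - 9 * n + 6 \<ge> 0\<close>. This fails at \<open>n = 8\<close>, hence the
        cutoff 36, which is \<open>9 choose 2\<close>.\<close>
      have "9 * real n \<le> real n * real n" using n by (intro mult_right_mono) auto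
      moreover have "(2 * real n - 3)\<^sup>2 = 4 * (real n * real n) - 12 * real n + 9"
        by (simp add: power2_eq_square algebra_simps)
      ultimately have "24 * real r + 9 \<le> (2 * real n - 3)\<^sup>2" using nr(2) by linarith
      then have "s \<le> 2 * real n - 3"
        unfolding s_def using n by (intro real_le_lsqrt) auto
      then have "4 * real n * s \<le> 4 * real n * (2 * real n - 3)"
        by (intro mult_left_mono) auto
      \<comment> \<open>The terms other than \<open>s\<^sup>2\<close> are at most
        \<open>4 * n * n + 4 * n * (2 * n - 3) = 24 * (n choose 2)\<close>.\<close>
      then have "(2 * real n + s)\<^sup>2 \<le> 24 * real y + 9"
        using s2 of_nat_choose_two[of n] by (simp add: nr power2_eq_square algebra_simps)
      then have "2 * real n + s \<le> sqrt (24 * real y + 9)" by (rule real_le_rsqrt)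
      with x(2) show ?thesis by (simp add: s_def)
    qed
    ultimately show ?thesis by blast
  qed
qed

text \<open>Inverting \<open>b\<close> modulo \<open>a\<close> gives \<open>y < a\<close> with
  \<open>z = a * k + y * b\<close>. A short representation for \<open>y\<close> uses some
  \<open>x \<le> k\<close>, and the remaining \<open>k - x\<close> copies of \<open>a\<close> are
  free.\<close>

lemma large_in_S:
  fixes z :: int
  assumes "a \<ge> 1" "coprime a b"
    and z: "real_of_int z > real a / 2 * (3 + sqrt (24 * real a - 15)) + real a * real b - real a - real b"
  shows "z \<in> int ` S a b"
proof -
  obtain c where c: "[int b * c = 1] (mod int a)"
    using cong_solve_coprime_int[of "int b" "int a"] assms(2) by (auto simp: coprime_commute)
  define y where "y = nat ((c * z) mod int a)"
  have y: "int y = (c * z) mod int a" "y < a"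
    using assms(1) by (auto simp: y_def nat_less_iff)
  have "[int y = c * z] (mod int a)" by (simp add: y cong_def)
  then have "[int y * int b = (c * z) * int b] (mod int a)" by (rule cong_scalar_right)
  also have "(c * z) * int b = (int b * c) * z" by simp
  also have "[(int b * c) * z = 1 * z] (mod int a)" using c by (rule cong_scalar_right)
  finally have "int a dvd z - int y * int b" by (simp add: cong_iff_dvd_diff dvd_diff_commute)
  then obtain k where "z - int y * int b = int a * k" by blast
  then have k: "z = int a * k + int y * int b" by simp
  define T where "T = (3 + sqrt (24 * real a - 15)) / 2"
  obtain x where x: "x * a + y * b \<in> S a b" "2 * real x \<le> 3 + sqrt (24 * real y + 9)"
    using short_representation by blast
  note x(2)
  also have "3 + sqrt (24 * real y + 9) \<le> 3 + sqrt (24 * real a - 15)" using y(2) by simp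
  finally have xT: "real x \<le> T" by (simp add: T_def)
  have "real y * real b \<le> (real a - 1) * real b" using y(2) by (intro mult_right_mono) auto
  moreover have "real_of_int z = real a * of_int k + real y * real b" by (simp add: k)
  ultimately have "real a * (T - 1) < real a * of_int k"
    using z by (simp add: T_def field_simps)
  then have "T - 1 < of_int k" using assms(1) by simp
  \<comment> \<open>Integrality turns \<open>x < k + 1\<close> into
    \<open>x \<le> k\<close>.\<close>
  with xT have xk: "int x \<le> k" by linarith
  have "z = int ((x * a + y * b) + nat (k - int x) * a)"
    using xk by (simp add: k algebra_simps)
  then show ?thesis using add_in_S[OF x(1) mult_in_S] by blast
qed

text \<open>Any representation has \<open>y\<close> congruent to -1 modulo \<open>a\<close>, so
  \<open>y \<ge> a - 1 > 0\<close>; the root bound then forces \<open>x > k\<close>, making the sum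
  exceed \<open>z\<close>.\<close>

lemma not_in_S:
  fixes z :: int
  assumes a: "a \<ge> 2" and cop: "coprime a b"
    and z: "z = int a * k + (int a - 1) * int b"
    and k: "2 * real_of_int k < 1 + sqrt (8 * real a - 7)"
  shows "z \<notin> int ` S a b"
proof
  assume "z \<in> int ` S a b"
  then obtain x y where xy: "z = int (x * a + y * b)" "y \<le> x choose 2"
    by (auto elim!: S_elim)
  have "(int y + 1) * int b = int a * (k + int b - int x)"
    using xy(1) z by (simp add: algebra_simps)
  then have "int a dvd (int y + 1) * int b" by simp
  then have "int a dvd int (y + 1)" using cop by (simp add: coprime_dvd_mult_left_iff add.commute)
  then have "a dvd y + 1" by (simp only: of_nat_dvd_iff)
  then have ya: "a \<le> y + 1" by (rule dvd_imp_le) simp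
  have "sqrt (8 * real a - 7) \<le> sqrt (8 * real y + 1)" using ya by simp
  moreover have "1 + sqrt (8 * real y + 1) \<le> 2 * real x"
    using ya a by (intro choose_two_root_bound xy(2)) auto
  ultimately have "k < int x" using k by linarith
  then have "int a * k < int a * int x" using a by simp
  moreover have "(int a - 1) * int b \<le> int y * int b"
    using ya by (intro mult_right_mono) auto
  ultimately show False using xy(1) z by (simp add: algebra_simps)
qed

text \<open>Cutting the set off below the witness \<open>k\<close> makes it finite, so
  \<open>Max\<close> applies.\<close>

lemma int_GreatestI:
  fixes P :: "int \<Rightarrow> bool"
  assumes "P k" and bound: "\<And>y. P y \<Longrightarrow> y \<le> B"
  shows "P (GREATEST x. P x) \<and> (\<forall>y. P y \<longrightarrow> y \<le> (GREATEST x. P x))"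
proof -
  let ?A = "{y. P y \<and> k \<le> y}"
  have "?A \<subseteq> {k..B}" using bound by auto
  then have fin: "finite ?A" using finite_subset by blast
  have ne: "?A \<noteq> {}" using assms(1) by auto
  have "P (Max ?A)" using Max_in[OF fin ne] by simp
  moreover have "y \<le> Max ?A" if "P y" for y
  proof (cases "k \<le> y")
    case True
    then show ?thesis using that by (intro Max_ge[OF fin]) simp
  next
    case False
    then show ?thesis using Max_in[OF fin ne] by simp
  qed
  ultimately show ?thesis using Greatest_equality[of P "Max ?A"] by auto
qed

lemma frobenius_greatest:
  assumes "\<And>z. z \<notin> int ` T \<Longrightarrow> z \<le> B"
  shows "frobenius T \<notin> int ` T" and "z \<notin> int ` T \<Longrightarrow> z \<le> frobenius T"
proof -
  \<comment> \<open>This gap exists even if \<open>T\<close> contains every natural number.\<close>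
  have "-1 \<notin> int ` T" by auto
  from int_GreatestI[of "\<lambda>z. z \<notin> int ` T", OF this assms]
  show "frobenius T \<notin> int ` T" and "z \<notin> int ` T \<Longrightarrow> z \<le> frobenius T"
    unfolding frobenius_def by auto
qed

theorem theorem8p2:
  fixes a b :: nat
  assumes "a \<ge> 1" and "b \<ge> 1" and "gcd a b = 1"
    and "(a, b) \<notin> {(29, 1), (45, 1), (47, 1), (50, 1), (55, 1), (67, 1), (73, 1), (79, 1)}"
  shows "(a \<ge> 2 \<longrightarrow>
           real_of_int (frobenius (S a b)) \<ge>
             real a / 2 * (1 + sqrt (8 * real a - 7)) + real a * real b - real a - real b) \<and>
         real_of_int (frobenius (S a b)) \<le>
           real a / 2 * (3 + sqrt (24 * real a - 15)) + real a * real b - real a - real b"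
proof -
  define U where "U = real a / 2 * (3 + sqrt (24 * real a - 15)) + real a * real b - real a - real b"
  have cop: "coprime a b" using assms(3) by (simp add: coprime_iff_gcd_eq_1)
  have U: "real_of_int z \<le> U" if "z \<notin> int ` S a b" for z
    using large_in_S[OF assms(1) cop, of z] that unfolding U_def by linarith
  then have "z \<le> \<lfloor>U\<rfloor>" if "z \<notin> int ` S a b" for z
    using that by (simp add: le_floor_iff)
  note frob = frobenius_greatest[of "S a b", OF this]
  have "real a / 2 * (1 + sqrt (8 * real a - 7)) + real a * real b - real a - real b
      \<le> real_of_int (frobenius (S a b))" if a: "a \<ge> 2"
  proof -
    define T where "T = (1 + sqrt (8 * real a - 7)) / 2"
    \<comment> \<open>The largest integer strictly below \<open>T\<close>: \<open>not_in_S\<close>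
      needs strictness, and \<open>k \<ge> T - 1\<close> gives the term \<open>- a\<close> of the
      bound.\<close>
    define k where "k = \<lceil>T\<rceil> - 1"
    have k: "of_int k < T" "T - 1 \<le> of_int k" unfolding k_def by linarith+
    have "int a * k + (int a - 1) * int b \<le> frobenius (S a b)"
      using k(1) by (intro frob(2) not_in_S[OF a cop refl]) (simp_all add: T_def)
    then have "real_of_int (int a * k + (int a - 1) * int b) \<le> frobenius (S a b)"
      by (simp only: of_int_le_iff)
    moreover have "real a * (T - 1) \<le> real a * of_int k" using k(2) by (intro mult_left_mono) auto
    ultimately show ?thesis by (simp add: T_def field_simps)
  qed
  with U[OF frob(1)] show ?thesis unfolding U_def by blast
qed

end
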